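(* Suppose that $0\le k\le k_{max4}$, where $$k_{max4}=\min\{M-1,\;M+1-M',\;2M-1,\;2M+1-M',\;2M+3-2M'\},$$ and let $h_0,h_1,\dots,h_k$ be given scalar functions of $x$. Then the bilinear constraints $$\sum_{i=0}^{j}\operatorname{Tr}(v_iv_{j-i})=h_j,\qquad j=0,1,\dots,k,$$ are preserved by the Darboux transformation such that $\det T_0\ne0$; that is, if they hold for the $v_i$, then $\sum_{i=0}^{j}\operatorname{Tr}(\tilde v_i\tilde v_{j-i})=h_j$ for $j=0,1,\dots,k$.
   Context: $x=(x^1,x^2)$; $,_2$ denotes the derivative with respect to $x^2$, taking into account the possible dependence of the spectral parameter $\lambda$ on $x$. The linear equation $\Psi,_2=V\Psi$ (one of the two equations of a Lax pair) has $n\times n$ matrix $$V=\sum_{k=0}^\infty v_k\lambda^{M-k}$$ for $\lambda$ near $\infty$, with $M$ a fixed positive integer and $v_k=v_k(x)$ (usually only finitely many are nonzero). The spectral parameter satisfies $\lambda,_2=\sum_{k=0}^\infty b_k\lambda^{M'-k}$ with scalar $b_k=b_k(x)$ and a given integer $M'$ (in the nonisospectral case fixed by requiring $b_0\ne0$; the isospectral case is $\lambda,_2=0$). A Darboux transformation replaces $V$ by $\tilde V=D,_2D^{-1}+DVD^{-1}$, where the Darboux matrix $D$ is analytic at $\lambda=\infty$, $D=T_0+T_1\lambda^{-1}+T_2\lambda^{-2}+\dots$ with $T_k=T_k(x)$, and is such that $\tilde V$ is of the same form as $V$: $\tilde V=\sum_{k\ge0}\tilde v_k\lambda^{M-k}$.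 *)

theory Defs
  imports "HOL-Analysis.Analysis"
begin

(* Points x = (x^1, x^2) are elements of real \<times> real.  A function of x and of the spectral
   parameter has type real \<times> real \<Rightarrow> complex \<Rightarrow> 'a; "near \<infinity>" is eventuality along at_infinity. *)

type_synonym 'n cmat = "complex^'n^'n"

(* HOL-Analysis has no complex scaling of complex matrices (the operator *s scales by an entry). *)
definition cscale :: "complex \<Rightarrow> 'n::finite cmat \<Rightarrow> 'n cmat"  (infixr "*\<^sub>m" 75)
  where "z *\<^sub>m A = (\<chi> i j. z * A $ i $ j)"

definition mat_expansion_at_infinity ::
    "(complex \<Rightarrow> 'n::finite cmat) \<Rightarrow> int \<Rightarrow> (nat \<Rightarrow> 'n cmat) \<Rightarrow> bool"
  where "mat_expansion_at_infinity F m c \<longleftrightarrow>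
    (\<forall>\<^sub>F l in at_infinity. (\<lambda>k. (l powi (m - int k)) *\<^sub>m c k) sums F l)"

definition scalar_expansion_at_infinity ::
    "(complex \<Rightarrow> complex) \<Rightarrow> int \<Rightarrow> (nat \<Rightarrow> complex) \<Rightarrow> bool"
  where "scalar_expansion_at_infinity f m c \<longleftrightarrow>
    (\<forall>\<^sub>F l in at_infinity. (\<lambda>k. c k * l powi (m - int k)) sums f l)"

definition C1_on :: "('a::real_normed_vector \<Rightarrow> 'b::real_normed_vector) \<Rightarrow> 'a set \<Rightarrow> bool"
  where "C1_on G W \<longleftrightarrow>
    (\<exists>G' :: 'a \<Rightarrow> 'a \<Rightarrow>\<^sub>L 'b.
      (\<forall>p\<in>W. (G has_derivative blinfun_apply (G' p)) (at p)) \<and> continuous_on W G')"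

(* D is analytic at \<lambda> = \<infinity> with expansion D = T_0 + T_1 / \<lambda> + T_2 / \<lambda>^2 + ..., and depends smoothly
   on x: in the coordinate s = 1/\<lambda> at \<infinity>, (x, s) \<mapsto> \<Sum>k. T_k(x) s^k is C^1 on an open neighbourhood W
   of U \<times> {0}.  The radius of convergence may depend on x. *)
definition smooth_analytic_at_infinity ::
    "(real \<times> real) set \<Rightarrow> (real \<times> real \<Rightarrow> complex \<Rightarrow> 'n::finite cmat) \<Rightarrow>
     (nat \<Rightarrow> real \<times> real \<Rightarrow> 'n cmat) \<Rightarrow> bool"
  where "smooth_analytic_at_infinity U D T \<longleftrightarrow>
    (\<exists>(W :: ((real \<times> real) \<times> complex) set) G.
      open W \<and> (\<forall>x\<in>U. (x, 0) \<in> W) \<and> C1_on G W \<and>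
      (\<forall>(x, s)\<in>W. (\<lambda>k. (s ^ k) *\<^sub>m T k x) sums G (x, s) \<and>
        (s \<noteq> 0 \<longrightarrow> D x (1 / s) = G (x, s))))"

(* F,_2 = F' at (x, l): the derivative with respect to x^2 of x \<mapsto> F x (\<lambda>(x)) for every spectral
   parameter \<lambda> with value l at x that satisfies \<lambda>,_2 = L x \<lambda> there; \<gamma> is \<lambda> as a function of x^2 for
   fixed x^1.  Since such \<gamma> always exist, F' is unique. *)
definition has_d2 ::
    "(real \<times> real \<Rightarrow> complex \<Rightarrow> 'a::real_normed_vector) \<Rightarrow> 'a \<Rightarrow>
     (real \<times> real \<Rightarrow> complex \<Rightarrow> complex) \<Rightarrow> real \<times> real \<Rightarrow> complex \<Rightarrow> bool"
  where "has_d2 F F' L x l \<longleftrightarrow>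
    (\<forall>\<gamma> :: real \<Rightarrow> complex.
      \<gamma> (snd x) = l \<and> (\<gamma> has_vector_derivative L x l) (at (snd x)) \<longrightarrow>
      ((\<lambda>t. F (fst x, t) (\<gamma> t)) has_vector_derivative F') (at (snd x)))"

definition darboux_transformed ::
    "(real \<times> real) set \<Rightarrow> (real \<times> real \<Rightarrow> complex \<Rightarrow> complex) \<Rightarrow>
     (real \<times> real \<Rightarrow> complex \<Rightarrow> 'n::finite cmat) \<Rightarrow> (real \<times> real \<Rightarrow> complex \<Rightarrow> 'n cmat) \<Rightarrow>
     (real \<times> real \<Rightarrow> complex \<Rightarrow> 'n cmat) \<Rightarrow> bool"
  where "darboux_transformed U L D V Vt \<longleftrightarrow>
    (\<forall>x\<in>U. \<forall>\<^sub>F l in at_infinity. invertible (D x l) \<and>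
      (\<exists>D2. has_d2 D D2 L x l \<and>
        Vt x l = D2 ** matrix_inv (D x l) + D x l ** V x l ** matrix_inv (D x l)))"

definition k_max4 :: "int \<Rightarrow> int \<Rightarrow> int"
  where "k_max4 M M' = Min {M - 1, M + 1 - M', 2 * M - 1, 2 * M + 1 - M', 2 * M + 3 - 2 * M'}"

end

theory Submission
  imports Defs "HOL-Library.Landau_Symbols"
begin

text \<open>Write \<open>D2 = D,\<^sub>2\<close> and \<open>Z = D\<^sup>-\<^sup>1 D2\<close>, so that \<open>Vt = D (V + Z) D\<^sup>-\<^sup>1\<close> and
  \<open>Tr Vt\<^sup>2 - Tr V\<^sup>2 = Tr Z\<^sup>2 + 2 Tr (Z V)\<close>.  In the coordinate \<open>s = 1 / \<lambda>\<close> the chain rule gives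
  \<open>D2 = O(1 + s\<^sup>2 \<lambda>,\<^sub>2)\<close>, and \<open>D\<^sup>-\<^sup>1\<close> is bounded because \<open>det T\<^sub>0 \<noteq> 0\<close>; hence \<open>Z = O(s\<^sup>p)\<close> with
  \<open>p = min 0 (2 - M')\<close>.  Together with \<open>V = O(s\<^sup>-\<^sup>M)\<close> this makes the power series
  \<open>s\<^sup>2\<^sup>M (Tr Vt\<^sup>2 - Tr V\<^sup>2)\<close> an \<open>o(s\<^sup>k)\<close>, so its coefficients up to
  index \<open>k\<close>, the changes of the bilinear expressions, vanish.\<close>

section \<open>Orders of vanishing at \<open>s = 0\<close>\<close>

lemma powi_bigo:
  assumes "b \<le> a"
  shows "(\<lambda>s::complex. s powi a) \<in> O[at 0](\<lambda>s. s powi b)"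
proof (rule bigoI[where c = 1])
  have "\<forall>\<^sub>F s::complex in at 0. s \<noteq> 0 \<and> norm s < 1"
    using eventually_at_ball[of 1 "0::complex" UNIV]
    by (auto simp: eventually_at_filter elim!: eventually_mono)
  then show "\<forall>\<^sub>F s::complex in at 0. norm (s powi a) \<le> 1 * norm (s powi b)"
    by eventually_elim (use assms in \<open>auto simp: norm_power_int intro!: power_int_decreasing\<close>)
qed

lemma powi_smallo:
  assumes "b < a"
  shows "(\<lambda>s::complex. s powi a) \<in> o[at 0](\<lambda>s. s powi b)"
proof -
  \<comment> \<open>One factor \<open>s\<close>, which tends to 0, is split off to make the
    comparison strict; as the exponents are integers, \<open>b \<le> a - 1\<close> is left for the
    other factor.\<close>
  have "(\<lambda>s::complex. s) \<in> o[at 0](\<lambda>_. 1)"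
    by (auto intro!: smalloI_tendsto tendsto_eq_intros)
  then have "(\<lambda>s::complex. s * s powi (a - 1)) \<in> o[at 0](\<lambda>s. 1 * s powi b)"
    by (rule landau_o.small_big_mult) (use assms in \<open>auto intro: powi_bigo\<close>)
  then have "(\<lambda>s::complex. s * s powi (a - 1)) \<in> o[at 0](\<lambda>s. s powi b)"
    by simp
  moreover have "\<forall>\<^sub>F s::complex in at 0. s * s powi (a - 1) = s powi a"
    by (auto simp: eventually_at_filter power_int_diff)
  ultimately show ?thesis
    by (simp cong: landau_o.small.in_cong)
qed

text \<open>Otherwise the lowest nonzero coefficient would have an index \<open>n \<le> k\<close>,
  and \<open>f z / z ^ n\<close> would tend both to that coefficient and to 0.\<close>

lemma fps_nth_eq_0_if_smallo:
  fixes F :: "complex fps"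
  assumes F: "f has_fps_expansion F" and small: "f \<in> o[at 0](\<lambda>z. z ^ k)" and "j \<le> k"
  shows "fps_nth F j = 0"
proof (rule ccontr)
  define n where "n = subdegree F"
  assume "fps_nth F j \<noteq> 0"
  then have "F \<noteq> 0" and "n \<le> k"
    using \<open>j \<le> k\<close> subdegree_leI[of F j] by (auto simp: n_def)
  \<comment> \<open>Division by zero yields 0, so for \<open>n > 0\<close> the value that makes the
    quotient continuous at 0 is filled in by hand.\<close>
  define g where "g = (\<lambda>z. if z = 0 then fps_nth F n else f z / z ^ n)"
  have "g has_fps_expansion fps_shift n F"
    unfolding g_def by (rule has_fps_expansion_shift) (auto simp: F n_def)
  then have "isCont g 0"
    using has_fps_expansion_imp_continuous by fastforce
  then have "g \<midarrow>0\<rightarrow> fps_nth F n"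
    by (simp add: isCont_def g_def)
  moreover have "\<forall>\<^sub>F z in at 0. g z = f z / z ^ n"
    by (auto simp: g_def eventually_at_filter)
  ultimately have "((\<lambda>z. f z / z ^ n) \<longlongrightarrow> fps_nth F n) (at 0)"
    by (simp cong: tendsto_cong)
  moreover have "f \<in> o[at 0](\<lambda>z. z ^ n)"
    using landau_o.small_big_trans[OF small] powi_bigo[of "int n" "int k"] \<open>n \<le> k\<close> by simp
  then have "((\<lambda>z. f z / z ^ n) \<longlongrightarrow> 0) (at 0)"
    by (rule smalloD_tendsto)
  ultimately have "fps_nth F n = 0"
    using tendsto_unique[OF trivial_limit_at] by blast
  then show False
    using \<open>F \<noteq> 0\<close> by (simp add: n_def)
qed

section \<open>Expansions at infinity as power series in \<open>s = 1 / l\<close>\<close>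

text \<open>Substituting \<open>l = inverse s\<close> and multiplying by \<open>s powi m\<close>
  turns each term into \<open>c k * s ^ k\<close>.\<close>

lemma scalar_expansion_fps:
  assumes "scalar_expansion_at_infinity f m c"
  shows "eval_fps (Abs_fps c) has_fps_expansion Abs_fps c"
    and "\<forall>\<^sub>F s in at 0. eval_fps (Abs_fps c) s = s powi m * f (inverse s)"
proof -
  have "\<forall>\<^sub>F s in at 0. (\<lambda>k. c k * inverse s powi (m - int k)) sums f (inverse s)"
    using assms filterlim_inverse_at_infinity
    unfolding scalar_expansion_at_infinity_def filterlim_iff by blast
  moreover have "\<forall>\<^sub>F s::complex in at 0. s \<noteq> 0"
    by (simp add: eventually_at_filter)
  ultimately have *: "\<forall>\<^sub>F s in at 0. s \<noteq> 0 \<and> (\<lambda>k. c k * s ^ k) sums (s powi m * f (inverse s))"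
  proof eventually_elim
    case (elim s)
    have "s powi m * (c k * inverse s powi (m - int k)) = c k * s ^ k" for k
      using elim(2) by (simp add: power_int_inverse power_int_diff)
    then show ?case
      using sums_mult[OF elim(1), of "s powi m"] elim(2) by (simp only: simp_thms not_False_eq_True)
  qed
  \<comment> \<open>Convergence at a single nonzero point already forces a positive radius of
    convergence.\<close>
  then obtain s where "s \<noteq> 0" "summable (\<lambda>k. c k * s ^ k)"
    using eventually_happens[OF *] by (auto simp: sums_iff)
  then have "0 < ereal (norm s)" "ereal (norm s) \<le> fps_conv_radius (Abs_fps c)"
    using conv_radius_geI by (auto simp: fps_conv_radius_def)
  then have "fps_conv_radius (Abs_fps c) > 0"
    by (rule less_le_trans)
  then show "eval_fps (Abs_fps c) has_fps_expansion Abs_fps c"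
    by (rule eval_fps_has_fps_expansion)
  show "\<forall>\<^sub>F s in at 0. eval_fps (Abs_fps c) s = s powi m * f (inverse s)"
    using * by eventually_elim (simp add: eval_fps_def sums_iff)
qed

text \<open>What remains after removing the factor \<open>s powi (- m)\<close> agrees near 0 with a
  convergent power series, hence is bounded.\<close>

lemma scalar_expansion_bigo:
  assumes "scalar_expansion_at_infinity f m c"
  shows "(\<lambda>s. f (inverse s)) \<in> O[at 0](\<lambda>s. s powi (- m))"
proof -
  define g where "g = eval_fps (Abs_fps c)"
  have "isCont g 0"
    using has_fps_expansion_imp_continuous[OF scalar_expansion_fps(1)[OF assms]] by (simp add: g_def)
  then have "g \<midarrow>0\<rightarrow> g 0"
    by (simp add: isCont_def)
  then have "g \<in> O[at 0](\<lambda>_. 1)"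
    by (intro bigoI_tendsto[where c = "g 0"]) auto
  then have "(\<lambda>s. s powi (- m) * g s) \<in> O[at 0](\<lambda>s. s powi (- m) * 1)"
    by (rule landau_o.big.mult[OF landau_o.big_refl])
  moreover have "\<forall>\<^sub>F s in at 0. s powi (- m) * g s = f (inverse s)"
    using scalar_expansion_fps(2)[OF assms, folded g_def]
    by (auto simp: eventually_at_filter power_int_minus elim!: eventually_mono)
  ultimately show ?thesis
    using landau_o.big.in_cong by fastforce
qed

lemma mat_expansion_entry:
  fixes F :: "complex \<Rightarrow> complex^'n::finite^'n"
  assumes "mat_expansion_at_infinity F m c"
  shows "scalar_expansion_at_infinity (\<lambda>l. F l $ i $ j) m (\<lambda>k. c k $ i $ j)"
proof -
  have "bounded_linear (\<lambda>A::complex^'n^'n. A $ i $ j)"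
    by (intro bounded_linear_compose[OF bounded_linear_vec_nth] bounded_linear_vec_nth)
  from bounded_linear.sums[OF this] show ?thesis
    using assms unfolding mat_expansion_at_infinity_def scalar_expansion_at_infinity_def
    by (fastforce simp: cscale_def mult.commute elim!: eventually_mono)
qed

lemma trace_matrix_mul: "trace (A ** B) = (\<Sum>a\<in>UNIV. \<Sum>b\<in>UNIV. A $ a $ b * B $ b $ a)"
  by (simp add: trace_def matrix_matrix_mult_def)

text \<open>The bilinear expressions are Cauchy product coefficients, so all constraints at one
  point are packed into a single scalar function analytic at \<open>s = 0\<close>.\<close>

lemma mat_expansion_trace_square:
  fixes F :: "complex \<Rightarrow> complex^'n::finite^'n"
  assumes "mat_expansion_at_infinity F m c"
  obtains f where
    "f has_fps_expansion Abs_fps (\<lambda>j. \<Sum>i=0..j. trace (c i ** c (j - i)))"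
    "\<forall>\<^sub>F s in at 0. f s = s powi (2 * m) * trace (F (inverse s) ** F (inverse s))"
proof
  define e where "e = (\<lambda>a b. Abs_fps (\<lambda>k. c k $ a $ b))"
  define f where "f = (\<lambda>s. \<Sum>a\<in>UNIV. \<Sum>b\<in>UNIV. eval_fps (e a b) s * eval_fps (e b a) s)"
  have entry: "eval_fps (e a b) has_fps_expansion e a b"
    "\<forall>\<^sub>F s in at 0. eval_fps (e a b) s = s powi m * F (inverse s) $ a $ b" for a b
    using scalar_expansion_fps[OF mat_expansion_entry[OF assms]] by (auto simp: e_def)
  have "(\<Sum>a\<in>UNIV. \<Sum>b\<in>UNIV. e a b * e b a) = Abs_fps (\<lambda>j. \<Sum>i=0..j. trace (c i ** c (j - i)))"
    (is "_ = ?S")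
  proof (rule fps_ext)
    fix j
    have "fps_nth (\<Sum>a\<in>UNIV. \<Sum>b\<in>UNIV. e a b * e b a) j =
        (\<Sum>a\<in>UNIV. \<Sum>b\<in>UNIV. \<Sum>i=0..j. c i $ a $ b * c (j - i) $ b $ a)"
      by (simp add: fps_sum_nth fps_mult_nth e_def)
    also have "\<dots> = (\<Sum>a\<in>UNIV. \<Sum>i=0..j. \<Sum>b\<in>UNIV. c i $ a $ b * c (j - i) $ b $ a)"
      by (intro sum.cong refl sum.swap)
    also have "\<dots> = (\<Sum>i=0..j. trace (c i ** c (j - i)))"
      unfolding trace_matrix_mul by (rule sum.swap)
    finally show "fps_nth (\<Sum>a\<in>UNIV. \<Sum>b\<in>UNIV. e a b * e b a) j = fps_nth ?S j"
      by simp
  qed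
  moreover have "f has_fps_expansion (\<Sum>a\<in>UNIV. \<Sum>b\<in>UNIV. e a b * e b a)"
    unfolding f_def by (intro has_fps_expansion_sum has_fps_expansion_mult entry)
  ultimately show "f has_fps_expansion ?S"
    by simp
  have "\<forall>\<^sub>F s in at 0. \<forall>a b. eval_fps (e a b) s = s powi m * F (inverse s) $ a $ b"
    by (intro eventually_all_finite entry)
  moreover have "\<forall>\<^sub>F s::complex in at 0. s \<noteq> 0"
    by (simp add: eventually_at_filter)
  ultimately show "\<forall>\<^sub>F s in at 0. f s = s powi (2 * m) * trace (F (inverse s) ** F (inverse s))"
  proof eventually_elim
    case (elim s)
    then have square: "s powi (2 * m) = s powi m * s powi m"
      by (simp flip: power_int_add)
    show ?case
      unfolding square using elim by (simp add: f_def trace_matrix_mul sum_distrib_left mult_ac)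
  qed
qed

section \<open>Matrix inverses and the Darboux matrix near infinity\<close>

lemma matrix_inv:
  assumes "invertible A"
  shows "A ** matrix_inv A = mat 1" and "matrix_inv A ** A = mat 1"
  using someI_ex[OF assms[unfolded invertible_def]] by (simp_all add: matrix_inv_def)

lemma bounded_bilinear_matrix_mult:
  "bounded_bilinear ((**) :: complex^'n::finite^'n \<Rightarrow> complex^'n^'n \<Rightarrow> complex^'n^'n)"
  unfolding bilinear_conv_bounded_bilinear[symmetric] bilinear_def
  by (auto intro!: linearI simp: matrix_matrix_mult_def vec_eq_iff sum.distrib
      algebra_simps scaleR_sum_right)

text \<open>If \<open>D \<longlongrightarrow> T\<close> and \<open>D ** E = 1\<close>, then \<open>E = T\<^sup>-\<^sup>1 ** (1 - (D - T) ** E)\<close>, whose last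
  term is eventually at most half of \<open>E\<close>.\<close>
lemma eventually_right_inverse_bounded:
  fixes T :: "complex^'n::finite^'n"
  assumes lim: "(D \<longlongrightarrow> T) F" and "invertible T" and inv: "\<forall>\<^sub>F s in F. D s ** E s = mat 1"
  obtains C where "\<forall>\<^sub>F s in F. norm (E s) \<le> C"
proof -
  obtain R where R: "R ** T = mat 1"
    using \<open>invertible T\<close> by (auto simp: invertible_def)
  interpret mm: bounded_bilinear "(**) :: complex^'n^'n \<Rightarrow> complex^'n^'n \<Rightarrow> complex^'n^'n"
    by (rule bounded_bilinear_matrix_mult)
  have "((\<lambda>s. norm (R ** (D s - T))) \<longlongrightarrow> norm (R ** (T - T))) F"
    by (intro tendsto_intros mm.tendsto lim)
  then have "((\<lambda>s. norm (R ** (D s - T))) \<longlongrightarrow> 0) F"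
    by (simp add: mm.zero_right)
  from mm.pos_bounded obtain K where K: "K > 0"
      "\<And>(A :: complex^'n^'n) (B :: complex^'n^'n). norm (A ** B) \<le> norm A * norm B * K"
    by blast
  \<comment> \<open>The threshold cancels the product constant \<open>K\<close> and leaves the
    factor 1/2; absorbing half of \<open>norm (E s)\<close> on the left gives the bound
    \<open>2 * norm R\<close>.\<close>
  have "\<forall>\<^sub>F s in F. norm (R ** (D s - T)) < 1 / (2 * K)"
    using K(1) by (intro order_tendstoD(2)[OF \<open>(_ \<longlongrightarrow> 0) F\<close>]) auto
  with inv have "\<forall>\<^sub>F s in F. norm (E s) \<le> 2 * norm R"
  proof eventually_elim
    case (elim s)
    have "E s = R ** T ** E s"
      by (simp add: R)
    also have "\<dots> = R ** (D s ** E s) - R ** (D s - T) ** E s"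
      by (simp add: mm.diff_left mm.diff_right matrix_mul_assoc)
    also have "\<dots> = R - R ** (D s - T) ** E s"
      using elim(1) by simp
    finally have "norm (E s) \<le> norm R + norm (R ** (D s - T) ** E s)"
      by (metis norm_triangle_ineq4)
    also have "norm (R ** (D s - T) ** E s) \<le> norm (R ** (D s - T)) * norm (E s) * K"
      by (rule K)
    also have "\<dots> \<le> 1 / (2 * K) * norm (E s) * K"
      using elim(2) K(1) by (intro mult_right_mono) auto
    finally show ?case
      using K(1) by simp
  qed
  then show ?thesis
    by (rule that)
qed

text \<open>The line through \<open>l\<close> with slope \<open>L x l\<close> is an admissible spectral parameter, and along it
  \<open>D (x\<^sup>1, t) (\<gamma> t) = G ((x\<^sup>1, t), 1 / \<gamma> t)\<close> for the \<open>C\<^sup>1\<close> function \<open>G\<close> in the coordinate \<open>s = 1 / \<lambda>\<close>.\<close>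
lemma has_d2_norm_bound:
  fixes D :: "real \<times> real \<Rightarrow> complex \<Rightarrow> complex^'n::finite^'n"
  assumes D: "smooth_analytic_at_infinity U D T" and "x \<in> U"
  obtains C where "\<forall>\<^sub>F s in at 0. \<forall>L D2. has_d2 D D2 L x (inverse s) \<longrightarrow>
    norm D2 \<le> C * (1 + norm (s\<^sup>2 * L x (inverse s)))"
proof -
  from D obtain W G where "open W" and W: "(x, 0) \<in> W" and "C1_on G W"
    and G: "\<And>x s. (x, s) \<in> W \<Longrightarrow> s \<noteq> 0 \<Longrightarrow> D x (1 / s) = G (x, s)"
    using \<open>x \<in> U\<close> unfolding smooth_analytic_at_infinity_def by fast
  then obtain G' :: "(real \<times> real) \<times> complex \<Rightarrow> ((real \<times> real) \<times> complex) \<Rightarrow>\<^sub>L (complex^'n^'n)"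
    where G': "\<And>p. p \<in> W \<Longrightarrow> (G has_derivative blinfun_apply (G' p)) (at p)"
      and cont: "continuous_on W G'"
    unfolding C1_on_def by blast
  \<comment> \<open>The summand 1 leaves room for the strict inequality that continuity of
    \<open>G'\<close> provides near \<open>(x, 0)\<close>.\<close>
  define C where "C = norm (G' (x, 0)) + 1"
  have pair: "((\<lambda>s. (x, s)) \<longlongrightarrow> (x, 0)) (at 0)"
    by (intro tendsto_intros)
  have "isCont G' (x, 0)"
    using cont W \<open>open W\<close> continuous_on_eq_continuous_at by blast
  then have "((\<lambda>s. G' (x, s)) \<longlongrightarrow> G' (x, 0)) (at 0)"
    using pair by (rule isCont_tendsto_compose)
  then have "\<forall>\<^sub>F s in at 0. norm (G' (x, s)) < C"
    by (intro order_tendstoD(2)[OF tendsto_norm]) (auto simp: C_def)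
  moreover have "\<forall>\<^sub>F s in at 0. (x, s) \<in> W"
    using topological_tendstoD[OF pair \<open>open W\<close> W] .
  moreover have "\<forall>\<^sub>F s::complex in at 0. s \<noteq> 0"
    by (simp add: eventually_at_filter)
  ultimately have "\<forall>\<^sub>F s in at 0. \<forall>L D2. has_d2 D D2 L x (inverse s) \<longrightarrow>
    norm D2 \<le> C * (1 + norm (s\<^sup>2 * L x (inverse s)))"
  proof eventually_elim
    case (elim s)
    show ?case
    proof (intro allI impI)
      fix L D2
      assume d2: "has_d2 D D2 L x (inverse s)"
      define \<gamma> where "\<gamma> = (\<lambda>t. inverse s + (t - snd x) *\<^sub>R L x (inverse s))"
      \<comment> \<open>This is the velocity of the curve \<open>q\<close> below: \<open>x^1\<close>
        is fixed, \<open>x^2\<close> has speed 1, and \<open>1 / \<gamma>\<close> has derivative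
        \<open>- \<gamma>' / \<gamma>^2\<close>, where \<open>1 / \<gamma> = s\<close> at the base
        point.\<close>
      define \<delta> where "\<delta> = ((0::real, 1::real), - (s\<^sup>2 * L x (inverse s))) "
      define q where "q = (\<lambda>t. ((fst x, t), inverse (\<gamma> t)))"
      have \<gamma>: "\<gamma> (snd x) = inverse s"
        by (simp add: \<gamma>_def)
      have \<gamma>': "(\<gamma> has_vector_derivative L x (inverse s)) (at (snd x))"
        unfolding \<gamma>_def by (auto intro!: derivative_eq_intros simp: has_vector_derivative_def)
      have D2: "((\<lambda>t. D (fst x, t) (\<gamma> t)) has_vector_derivative D2) (at (snd x))"
        using d2 \<gamma> \<gamma>' by (simp add: has_d2_def)
      have q_x: "q (snd x) = (x, s)"
        by (simp add: q_def \<gamma>)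
      have q': "(q has_vector_derivative \<delta>) (at (snd x))"
        unfolding q_def \<delta>_def has_vector_derivative_def using \<open>s \<noteq> 0\<close> \<gamma>
        by (auto intro!: derivative_eq_intros \<gamma>'[unfolded has_vector_derivative_def]
            simp: power2_eq_square)
      have "(G has_derivative blinfun_apply (G' (x, s))) (at (q (snd x)))"
        using G'[OF elim(2)] by (simp add: q_x)
      then have "(G \<circ> q has_vector_derivative blinfun_apply (G' (x, s)) \<delta>) (at (snd x))"
        using q' unfolding has_vector_derivative_def
        by (auto simp: o_def blinfun.scaleR_right dest: has_derivative_compose)
      moreover have "\<forall>\<^sub>F t in at (snd x). (G \<circ> q) t = D (fst x, t) (\<gamma> t)"
      proof -
        have "isCont q (snd x)"
          using q' has_vector_derivative_continuous by blast
        then have "(q \<longlongrightarrow> (x, s)) (at (snd x))"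
          by (simp add: isCont_def q_x)
        \<comment> \<open>The slice \<open>s = 0\<close> is removed because \<open>D\<close> and
          \<open>G\<close> are identified only for nonzero \<open>s\<close>.\<close>
        moreover have "open (W - UNIV \<times> {0})"
          using \<open>open W\<close> by (intro open_Diff closed_Times) simp_all
        moreover have "(x, s) \<in> W - UNIV \<times> {0}"
          using elim by simp
        ultimately have "\<forall>\<^sub>F t in at (snd x). q t \<in> W - UNIV \<times> {0}"
          by (rule topological_tendstoD)
        then show ?thesis
        proof eventually_elim
          case (elim t)
          then show ?case
            using G[of "(fst x, t)" "inverse (\<gamma> t)"] by (auto simp: q_def field_simps)
        qed
      qed
      \<comment> \<open>The filter \<open>at (snd x)\<close> omits the point itself, so agreement
        there is checked separately.\<close>
      moreover have "(G \<circ> q) (snd x) = D (fst x, snd x) (\<gamma> (snd x))"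
        using G[OF elim(2,3)] by (simp add: q_x \<gamma> inverse_eq_divide)
      ultimately have "((\<lambda>t. D (fst x, t) (\<gamma> t)) has_vector_derivative blinfun_apply (G' (x, s)) \<delta>)
          (at (snd x))"
        unfolding has_vector_derivative_def by (auto intro: has_derivative_transform_eventually)
      then have "D2 = blinfun_apply (G' (x, s)) \<delta>"
        using D2 vector_derivative_unique_at by blast
      then have "norm D2 \<le> norm (G' (x, s)) * norm \<delta>"
        by (simp add: norm_blinfun)
      also have "norm \<delta> \<le> norm (0::real, 1::real) + norm (- (s\<^sup>2 * L x (inverse s)))"
        unfolding \<delta>_def by (rule norm_Pair_le)
      also have "\<dots> = 1 + norm (s\<^sup>2 * L x (inverse s))"
        by (simp add: norm_Pair)
      finally have "norm D2 \<le> norm (G' (x, s)) * (1 + norm (s\<^sup>2 * L x (inverse s)))"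
        by (simp add: mult_left_mono)
      also have "\<dots> \<le> C * (1 + norm (s\<^sup>2 * L x (inverse s)))"
        using elim(1) by (intro mult_right_mono) auto
      finally show "norm D2 \<le> C * (1 + norm (s\<^sup>2 * L x (inverse s)))" .
    qed
  qed
  then show ?thesis
    by (rule that)
qed

text \<open>At \<open>s = 0\<close> only the constant term of the series survives, and the sum is
  continuous there because it is differentiable.\<close>

lemma smooth_analytic_tendsto:
  fixes D :: "real \<times> real \<Rightarrow> complex \<Rightarrow> complex^'n::finite^'n"
  assumes D: "smooth_analytic_at_infinity U D T" and "x \<in> U"
  shows "((\<lambda>s. D x (inverse s)) \<longlongrightarrow> T 0 x) (at 0)"
proof -
  from D obtain W G where "open W" and W: "(x, 0) \<in> W" and "C1_on G W"
    and sums: "\<And>x s. (x, s) \<in> W \<Longrightarrow> (\<lambda>k. (s ^ k) *\<^sub>m T k x) sums G (x, s)"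
    and G: "\<And>x s. (x, s) \<in> W \<Longrightarrow> s \<noteq> 0 \<Longrightarrow> D x (1 / s) = G (x, s)"
    using \<open>x \<in> U\<close> unfolding smooth_analytic_at_infinity_def by fast
  have "(0 ^ k) *\<^sub>m T k x = (if k = 0 then T 0 x else 0)" for k
    by (simp add: cscale_def vec_eq_iff)
  then have "G (x, 0) = T 0 x"
    using sums[OF W] sums_single[of 0 "\<lambda>_. T 0 x"] sums_unique2 by fastforce
  have "isCont G (x, 0)"
    using \<open>C1_on G W\<close> W has_derivative_continuous unfolding C1_on_def by blast
  moreover have pair: "((\<lambda>s. (x, s)) \<longlongrightarrow> (x, 0)) (at 0)"
    by (intro tendsto_intros)
  ultimately have "((\<lambda>s. G (x, s)) \<longlongrightarrow> T 0 x) (at 0)"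
    using isCont_tendsto_compose \<open>G (x, 0) = T 0 x\<close> by fastforce
  moreover have "\<forall>\<^sub>F s in at 0. (x, s) \<in> W"
    using topological_tendstoD[OF pair \<open>open W\<close> W] .
  then have "\<forall>\<^sub>F s in at 0. G (x, s) = D x (inverse s)"
    using G[of x] by (auto simp: eventually_at_filter inverse_eq_divide elim!: eventually_mono)
  ultimately show ?thesis
    by (simp cong: tendsto_cong)
qed

section \<open>Order of the gauge term\<close>

text \<open>Orders add under multiplication; this treats each product of entries in the difference
  of the two traces.\<close>

lemma mult_powi_smallo:
  fixes u w :: "complex \<Rightarrow> complex"
  assumes u: "u \<in> O[at 0](\<lambda>s. s powi a)" and w: "w \<in> O[at 0](\<lambda>s. s powi b)"
    and "int k < m + a + b"
  shows "(\<lambda>s. s powi m * (u s * w s)) \<in> o[at 0](\<lambda>s. s ^ k)"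
proof -
  have "(\<lambda>s. s powi m * (u s * w s)) \<in> O[at 0](\<lambda>s. s powi m * (s powi a * s powi b))"
    by (intro landau_o.big.mult landau_o.big_refl u w)
  also have "(\<lambda>s::complex. s powi m * (s powi a * s powi b)) \<in> \<Theta>[at 0](\<lambda>s. s powi (m + a + b))"
    by (intro bigthetaI_cong) (simp add: eventually_at_filter power_int_add)
  also have "(\<lambda>s::complex. s powi (m + a + b)) \<in> o[at 0](\<lambda>s. s powi int k)"
    using assms by (intro powi_smallo)
  finally show ?thesis
    by simp
qed

text \<open>The gauge term \<open>E ** Vt ** D - V\<close> equals \<open>E ** D2\<close>; the exponent \<open>2 - M'\<close> comes from
  \<open>s\<^sup>2 * L\<close> with \<open>s = 1 / \<lambda>\<close>.\<close>
lemma darboux_gauge_term_bigo: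
  fixes D V Vt :: "real \<times> real \<Rightarrow> complex \<Rightarrow> complex^'n::finite^'n"
  assumes D: "smooth_analytic_at_infinity U D T" and "x \<in> U"
    and L: "scalar_expansion_at_infinity (L x) M' b"
    and darboux: "darboux_transformed U L D V Vt"
    and det: "det (T 0 x) \<noteq> 0"
  defines "E \<equiv> \<lambda>s. matrix_inv (D x (inverse s))"
  shows "(\<lambda>s. (E s ** Vt x (inverse s) ** D x (inverse s) - V x (inverse s)) $ i $ j)
    \<in> O[at 0](\<lambda>s. s powi min 0 (2 - M'))"
proof -
  define p where "p = min 0 (2 - M')"
  interpret mm: bounded_bilinear "(**) :: complex^'n^'n \<Rightarrow> complex^'n^'n \<Rightarrow> complex^'n^'n"
    by (rule bounded_bilinear_matrix_mult)
  from mm.pos_bounded obtain K where K: "K > 0"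
      "\<And>(A :: complex^'n^'n) (B :: complex^'n^'n). norm (A ** B) \<le> norm A * norm B * K"
    by blast
  have ev: "\<forall>\<^sub>F s in at 0. invertible (D x (inverse s)) \<and>
      (\<exists>D2. has_d2 D D2 L x (inverse s) \<and>
        Vt x (inverse s) = D2 ** E s + D x (inverse s) ** V x (inverse s) ** E s)"
    unfolding E_def
    by (rule eventually_compose_filterlim[OF _ filterlim_inverse_at_infinity])
      (use darboux \<open>x \<in> U\<close> in \<open>simp add: darboux_transformed_def\<close>)
  then have inv: "\<forall>\<^sub>F s in at 0. D x (inverse s) ** E s = mat 1"
    by eventually_elim (simp add: E_def matrix_inv)
  have "invertible (T 0 x)"
    using det invertible_det_nz by blast
  from smooth_analytic_tendsto[OF D \<open>x \<in> U\<close>] this inv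
  obtain CE where CE: "\<forall>\<^sub>F s in at 0. norm (E s) \<le> CE"
    by (rule eventually_right_inverse_bounded)
  obtain CD where CD: "\<forall>\<^sub>F s in at 0. \<forall>L D2. has_d2 D D2 L x (inverse s) \<longrightarrow>
      norm D2 \<le> CD * (1 + norm (s\<^sup>2 * L x (inverse s)))"
    by (rule has_d2_norm_bound[OF D \<open>x \<in> U\<close>])
  have "(\<lambda>s::complex. s powi 2 * L x (inverse s)) \<in> O[at 0](\<lambda>s. s powi 2 * s powi (- M'))"
    by (intro landau_o.big.mult landau_o.big_refl scalar_expansion_bigo[OF L])
  also have "(\<lambda>s::complex. s powi 2 * s powi (- M')) \<in> \<Theta>[at 0](\<lambda>s. s powi (2 - M'))"
    by (intro bigthetaI_cong)
      (simp add: eventually_at_filter power_int_diff power_int_minus divide_inverse)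
  also have "(\<lambda>s::complex. s powi (2 - M')) \<in> O[at 0](\<lambda>s. s powi p)"
    by (rule powi_bigo) (simp add: p_def)
  finally obtain c where c: "\<forall>\<^sub>F s in at 0. norm (s\<^sup>2 * L x (inverse s)) \<le> c * norm (s powi p)"
    by (auto elim!: landau_o.bigE)
  \<comment> \<open>The summand 1 in the bound on \<open>D2\<close> stems from the explicit
    dependence of \<open>D\<close> on \<open>x^2\<close>; it is the reason for the minimum with 0 in
    \<open>p\<close>.\<close>
  have "(\<lambda>s::complex. s powi 0) \<in> O[at 0](\<lambda>s. s powi p)"
    by (rule powi_bigo) (simp add: p_def)
  then obtain c1 where c1: "\<forall>\<^sub>F s::complex in at 0. 1 \<le> c1 * norm (s powi p)"
    by (auto elim!: landau_o.bigE)
  from ev CE CD c c1 have "\<forall>\<^sub>F s in at 0.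
    norm ((E s ** Vt x (inverse s) ** D x (inverse s) - V x (inverse s)) $ i $ j)
      \<le> (CE * \<bar>CD\<bar> * (c1 + c) * K) * norm (s powi p)"
  proof eventually_elim
    case (elim s)
    let ?D = "D x (inverse s)" and ?V = "V x (inverse s)"
    obtain D2 where "has_d2 D D2 L x (inverse s)"
      and Vt: "Vt x (inverse s) = D2 ** E s + ?D ** ?V ** E s"
      using elim(1) by blast
    then have "norm D2 \<le> CD * (1 + norm (s\<^sup>2 * L x (inverse s)))"
      using elim(3) by blast
    \<comment> \<open>The absolute value is taken because the sign of \<open>CD\<close> is not
      known.\<close>
    also have "\<dots> \<le> \<bar>CD\<bar> * ((c1 + c) * norm (s powi p))"
      using elim(4,5) by (intro mult_mono) (auto simp: distrib_right)
    finally have D2: "norm D2 \<le> \<bar>CD\<bar> * ((c1 + c) * norm (s powi p))" .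
    have ED: "E s ** ?D = mat 1"
      using elim(1) by (simp add: E_def matrix_inv)
    have "E s ** Vt x (inverse s) ** ?D = E s ** D2 ** (E s ** ?D) + (E s ** ?D) ** ?V ** (E s ** ?D)"
      by (simp add: Vt mm.add_left mm.add_right matrix_mul_assoc)
    then have "E s ** Vt x (inverse s) ** ?D - ?V = E s ** D2"
      by (simp add: ED)
    moreover have "norm ((E s ** D2) $ i $ j) \<le> norm (E s ** D2)"
      by (rule order_trans[OF Finite_Cartesian_Product.norm_nth_le Finite_Cartesian_Product.norm_nth_le])
    moreover have "norm (E s ** D2) \<le> norm (E s) * norm D2 * K"
      by (rule K)
    moreover have "norm (E s) * norm D2 * K \<le> CE * (\<bar>CD\<bar> * ((c1 + c) * norm (s powi p))) * K"
      using elim(2) D2 K(1) order_trans[OF norm_ge_zero elim(2)] by (intro mult_right_mono mult_mono) auto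
    ultimately show ?case
      by (simp add: mult_ac)
  qed
  then show ?thesis
    unfolding p_def by (rule bigoI)
qed

section \<open>Invariance of the bilinear constraints\<close>

text \<open>Cyclicity of the trace brings the outer \<open>D\<close> and \<open>E\<close> together,
  where they cancel. It serves to replace \<open>Vt\<close> by its conjugate
  \<open>V + Z\<close>.\<close>

lemma trace_square_similar:
  fixes B D E :: "complex^'n::finite^'n"
  assumes "D ** E = mat 1"
  shows "trace (B ** B) = trace ((E ** B ** D) ** (E ** B ** D))"
proof -
  have "(E ** B ** D) ** (E ** B ** D) = E ** (B ** (D ** E) ** B ** D)"
    by (simp add: matrix_mul_assoc)
  then have "trace ((E ** B ** D) ** (E ** B ** D)) = trace (B ** B ** D ** E)"
    using assms trace_mul_sym by fastforce
  also have "B ** B ** D ** E = B ** B ** (D ** E)"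
    by (simp add: matrix_mul_assoc)
  finally show ?thesis
    using assms by simp
qed

theorem proposition8p6:
  fixes U :: "(real \<times> real) set"
    and M M' :: int
    and V Vt D :: "real \<times> real \<Rightarrow> complex \<Rightarrow> 'n::finite cmat"
    and v vt T :: "nat \<Rightarrow> real \<times> real \<Rightarrow> 'n cmat"
    and L :: "real \<times> real \<Rightarrow> complex \<Rightarrow> complex"
    and b h :: "nat \<Rightarrow> real \<times> real \<Rightarrow> complex"
    and k :: nat
  assumes "open U"
    and "M > 0"
    and V: "\<And>x. x \<in> U \<Longrightarrow> mat_expansion_at_infinity (V x) M (\<lambda>i. v i x)"
    and L: "\<And>x. x \<in> U \<Longrightarrow> scalar_expansion_at_infinity (L x) M' (\<lambda>i. b i x)"
    and D: "smooth_analytic_at_infinity U D T"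
    and darboux: "darboux_transformed U L D V Vt"
    and Vt: "\<And>x. x \<in> U \<Longrightarrow> mat_expansion_at_infinity (Vt x) M (\<lambda>i. vt i x)"
    and det: "\<And>x. x \<in> U \<Longrightarrow> det (T 0 x) \<noteq> 0"
    and k: "int k \<le> k_max4 M M'"
    and constraints: "\<And>x j. x \<in> U \<Longrightarrow> j \<le> k \<Longrightarrow>
      (\<Sum>i=0..j. trace (v i x ** v (j - i) x)) = h j x"
  shows "\<forall>x\<in>U. \<forall>j\<le>k. (\<Sum>i=0..j. trace (vt i x ** vt (j - i) x)) = h j x"
proof (intro ballI allI impI)
  fix x j
  assume "x \<in> U" "j \<le> k"
  define p where "p = min 0 (2 - M')"
  define A where "A = (\<lambda>s. V x (inverse s))"
  \<comment> \<open>\<open>Z\<close> is written without \<open>D2\<close>, which is only known to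
    exist separately for each spectral value.\<close>
  define Z where "Z = (\<lambda>s. matrix_inv (D x (inverse s)) ** Vt x (inverse s) ** D x (inverse s) - A s)"
  obtain f where
      f: "f has_fps_expansion Abs_fps (\<lambda>j. \<Sum>i=0..j. trace (v i x ** v (j - i) x))"
    and f_eq: "\<forall>\<^sub>F s in at 0. f s = s powi (2 * M) * trace (A s ** A s)"
    unfolding A_def by (rule mat_expansion_trace_square[OF V[OF \<open>x \<in> U\<close>]])
  obtain ft where
      ft: "ft has_fps_expansion Abs_fps (\<lambda>j. \<Sum>i=0..j. trace (vt i x ** vt (j - i) x))"
    and ft_eq: "\<forall>\<^sub>F s in at 0. ft s = s powi (2 * M) * trace (Vt x (inverse s) ** Vt x (inverse s))"
    by (rule mat_expansion_trace_square[OF Vt[OF \<open>x \<in> U\<close>]])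
  have A: "(\<lambda>s. A s $ c $ d) \<in> O[at 0](\<lambda>s. s powi (- M))" for c d
    unfolding A_def by (rule scalar_expansion_bigo[OF mat_expansion_entry[OF V[OF \<open>x \<in> U\<close>]]])
  have Z: "(\<lambda>s. Z s $ c $ d) \<in> O[at 0](\<lambda>s. s powi p)" for c d
    unfolding Z_def A_def p_def
    by (rule darboux_gauge_term_bigo[OF D \<open>x \<in> U\<close> L[OF \<open>x \<in> U\<close>] darboux det[OF \<open>x \<in> U\<close>]])
  \<comment> \<open>These are the orders needed for the products \<open>Z Z\<close>,
    \<open>A Z\<close> and \<open>Z A\<close>. For \<open>p = 0\<close> they follow from
    \<open>int k \<le> M - 1\<close> and \<open>M > 0\<close>, for \<open>p = 2 - M'\<close> from
    \<open>int k \<le> M + 1 - M'\<close> and \<open>int k \<le> 2 * M + 3 - 2 * M'\<close>.\<close>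
  have bounds: "int k < 2 * M + p + p" "int k < 2 * M + - M + p" "int k < 2 * M + p + - M"
  proof -
    have "int k \<le> M - 1" "int k \<le> M + 1 - M'" "int k \<le> 2 * M + 3 - 2 * M'"
      using k by (simp_all add: k_max4_def)
    then show "int k < 2 * M + p + p" "int k < 2 * M + - M + p" "int k < 2 * M + p + - M"
      using \<open>M > 0\<close> by (auto simp: p_def min_def)
  qed
  have inv: "\<forall>\<^sub>F s in at 0. invertible (D x (inverse s))"
    by (rule eventually_compose_filterlim[OF _ filterlim_inverse_at_infinity])
      (use darboux \<open>x \<in> U\<close> in \<open>auto simp: darboux_transformed_def elim!: eventually_mono\<close>)
  \<comment> \<open>The square of \<open>A\<close> cancels against \<open>f\<close>, so every
    remaining product contains a factor from \<open>Z\<close>.\<close>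
  from inv f_eq ft_eq have diff: "\<forall>\<^sub>F s in at 0. ft s - f s = (\<Sum>c\<in>UNIV. \<Sum>d\<in>UNIV.
      s powi (2 * M) * (Z s $ c $ d * Z s $ d $ c)
      + s powi (2 * M) * (A s $ c $ d * Z s $ d $ c)
      + s powi (2 * M) * (Z s $ c $ d * A s $ d $ c))"
  proof eventually_elim
    case (elim s)
    have "trace (Vt x (inverse s) ** Vt x (inverse s)) = trace ((A s + Z s) ** (A s + Z s))"
      using trace_square_similar[of "D x (inverse s)" "matrix_inv (D x (inverse s))"] elim(1)
      by (simp add: Z_def matrix_inv)
    then show ?case
      by (simp add: elim(2,3) trace_matrix_mul sum_distrib_left algebra_simps
          flip: sum.distrib sum_subtractf)
  qed
  have "(\<lambda>s. \<Sum>c\<in>UNIV. \<Sum>d\<in>UNIV.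
      s powi (2 * M) * (Z s $ c $ d * Z s $ d $ c)
      + s powi (2 * M) * (A s $ c $ d * Z s $ d $ c)
      + s powi (2 * M) * (Z s $ c $ d * A s $ d $ c)) \<in> o[at 0](\<lambda>s. s ^ k)"
    by (intro big_sum_in_smallo sum_in_smallo mult_powi_smallo[OF Z Z bounds(1)]
        mult_powi_smallo[OF A Z bounds(2)] mult_powi_smallo[OF Z A bounds(3)])
  then have "(\<lambda>s. ft s - f s) \<in> o[at 0](\<lambda>s. s ^ k)"
    using landau_o.small.in_cong[OF diff] by blast
  from fps_nth_eq_0_if_smallo[OF has_fps_expansion_diff[OF ft f] this \<open>j \<le> k\<close>]
  show "(\<Sum>i=0..j. trace (vt i x ** vt (j - i) x)) = h j x"
    using constraints[OF \<open>x \<in> U\<close> \<open>j \<le> k\<close>] by simp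
qed

end
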